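(* Let $M$ be a simply-connected manifold (of arbitrary dimension) and let $H\subset M$ be a hypersurface which is closed as a subset of $M$. Then $H$ divides $M$, i.e. $M\setminus H$ is disconnected.
   Context: A manifold is a connected Hausdorff topological manifold without boundary, NOT assumed metrizable or second countable. A (locally flat) hypersurface in an $n$-manifold $M$ is a non-empty subset $H\subset M$ such that every $p\in H$ has an open neighbourhood $U$ in $M$ together with a homeomorphism of triads $(U,U\cap H,p)\cong(\mathbb R^n,\mathbb R^{n-1}\times\{0\},0)$. The hypersurface $H$ is not assumed to be compact or connected. *)

theory Defs
  imports "HOL-Analysis.Analysis"
begin

text \<open>Neither metrizability nor second countability is assumed, so the carrier type is
  unrestricted and a manifold is a general value of type \<open>'a topology\<close>.\<close>

definition manifold :: "nat \<Rightarrow> 'a topology \<Rightarrow> bool" where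
  "manifold n M \<longleftrightarrow>
     connected_space M \<and> Hausdorff_space M \<and>
     (\<forall>p \<in> topspace M. \<exists>U. openin M U \<and> p \<in> U \<and>
        subtopology M U homeomorphic_space Euclidean_space n)"

text \<open>The library's \<open>simply_connected\<close> is only available for subsets of type-class spaces.
  Here every loop based at \<open>x\<close> is required to be null-homotopic relative to its end points.\<close>

definition simply_connected_space :: "'a topology \<Rightarrow> bool" where
  "simply_connected_space X \<longleftrightarrow>
     path_connected_space X \<and>
     (\<forall>x \<in> topspace X. \<forall>g. pathin X g \<and> g 0 = x \<and> g 1 = x \<longrightarrow>
        homotopic_with (\<lambda>r. r 0 = x \<and> r 1 = x) (top_of_set {0..1::real}) X g (\<lambda>_. x))"

text \<open>Coordinates of \<open>Euclidean_space n\<close> are indexed by \<open>0, \<dots>, n - 1\<close>, so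
  \<open>\<real>\<^sup>n\<^sup>-\<^sup>1 \<times> {0}\<close> is the vanishing locus of the coordinate with index \<open>n - 1\<close>. It makes sense
  only for \<open>n \<ge> 1\<close>; without this condition the truncated subtraction would turn a point
  into a hypersurface of a \<open>0\<close>-manifold.\<close>

definition hypersurface :: "nat \<Rightarrow> 'a topology \<Rightarrow> 'a set \<Rightarrow> bool" where
  "hypersurface n M H \<longleftrightarrow>
     n \<ge> 1 \<and> H \<noteq> {} \<and> H \<subseteq> topspace M \<and>
     (\<forall>p \<in> H. \<exists>U f. openin M U \<and> p \<in> U \<and>
        homeomorphic_map (subtopology M U) (Euclidean_space n) f \<and>
        f ` (U \<inter> H) = {x \<in> topspace (Euclidean_space n). x (n - 1) = 0} \<and>
        f p = (\<lambda>_. 0))"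

definition divides :: "'a set \<Rightarrow> 'a topology \<Rightarrow> bool" where
  "divides H M \<longleftrightarrow> \<not> connected_space (subtopology M (topspace M - H))"

end

theory Submission
  imports Defs
begin

text \<open>A closed hypersurface determines a two-sheeted covering of \<open>M\<close>, whose fibre over a point
  consists of the two ways of labelling the local sides of \<open>H\<close> there. Over \<open>M - H\<close> it
  has the canonical section. Were \<open>M - H\<close> connected, hence path-connected, some loop
  would cross \<open>H\<close> exactly once. The pullback of the covering along a null-homotopy of
  this loop has a section over the unit square, glued from sections on small rectangles. Compared
  with the canonical section it is constant along the boundary of the square away from the crossing,
  but it has to change at the crossing.\<close>

section \<open>Germs of two-valued functions up to a constant\<close>

text \<open>Near \<open>m\<close> the two Z/2-valued functions differ by a constant.\<close>

definition coherent_at :: "'a topology \<Rightarrow> 'a \<Rightarrow> ('a \<Rightarrow> bool) \<Rightarrow> ('a \<Rightarrow> bool) \<Rightarrow> bool" where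
  "coherent_at X m f g \<longleftrightarrow>
     (\<exists>W. openin X W \<and> m \<in> W \<and> (\<forall>x\<in>W. (f x = f m) = (g x = g m)))"

lemma coherent_at_sym: "coherent_at X m f g \<Longrightarrow> coherent_at X m g f"
  unfolding coherent_at_def by blast

lemma coherent_at_trans:
  assumes "coherent_at X m f g" "coherent_at X m g h"
  shows "coherent_at X m f h"
proof -
  obtain V W where V: "openin X V" "m \<in> V" "\<forall>x\<in>V. (f x = f m) = (g x = g m)"
    and W: "openin X W" "m \<in> W" "\<forall>x\<in>W. (g x = g m) = (h x = h m)"
    using assms unfolding coherent_at_def by (elim exE conjE)
  show ?thesis
    unfolding coherent_at_def
    by (rule exI[of _ "V \<inter> W"]) (use V W in auto)
qed

lemma coherent_at_compose:
  assumes "coherent_at Y (h q) f g" "continuous_map X Y h" "q \<in> topspace X"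
  shows "coherent_at X q (f \<circ> h) (g \<circ> h)"
proof -
  obtain W where W: "openin Y W" "h q \<in> W" "\<forall>x\<in>W. (f x = f (h q)) = (g x = g (h q))"
    using assms(1) unfolding coherent_at_def by blast
  have "openin X {x \<in> topspace X. h x \<in> W}"
    using openin_continuous_map_preimage[OF assms(2) W(1)] .
  then show ?thesis
    unfolding coherent_at_def
    by (intro exI[of _ "{x \<in> topspace X. h x \<in> W}"]) (use W assms(3) in auto)
qed

lemma coherent_at_subtopology:
  assumes "coherent_at X m f g" "m \<in> A"
  shows "coherent_at (subtopology X A) m f g"
proof -
  obtain W where W: "openin X W" "m \<in> W" "\<forall>x\<in>W. (f x = f m) = (g x = g m)"
    using assms(1) unfolding coherent_at_def by blast
  show ?thesis
    unfolding coherent_at_def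
    by (intro exI[of _ "A \<inter> W"]) (use W assms(2) in \<open>auto intro: openin_subtopology_Int2\<close>)
qed

text \<open>Applied to the sign between two sections on an overlap, to a section along a set that
  \<open>h\<close> maps off \<open>H\<close>, and to the label of one chart on a half of a
  neighbourhood adapted to another. The topology is general because the last of these lives in
  \<open>M\<close>, the others in the plane.\<close>

lemma connectedin_locally_constant:
  assumes "connectedin X A"
    and loc: "\<And>x. x \<in> A \<Longrightarrow> \<exists>T. openin (subtopology X A) T \<and> x \<in> T \<and> (\<forall>y\<in>T. f y = f x)"
    and "x \<in> A" "y \<in> A"
  shows "f x = f y"
proof -
  let ?E1 = "{z \<in> A. f z = f x}" and ?E2 = "{z \<in> A. f z \<noteq> f x}"
  have sub: "T \<subseteq> A" if "openin (subtopology X A) T" for T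
    using openin_subset[OF that] by auto
  have o: "openin (subtopology X A) {z \<in> A. P (f z)}" for P
  proof (subst openin_subopen, intro ballI)
    fix z assume z: "z \<in> {z \<in> A. P (f z)}"
    then have "z \<in> A" by simp
    from loc[OF this] obtain T where T: "openin (subtopology X A) T" "z \<in> T" "\<forall>y\<in>T. f y = f z"
      by (elim exE conjE)
    have "T \<subseteq> {z \<in> A. P (f z)}" using sub[OF T(1)] T(3) z by auto
    with T(1,2) show "\<exists>T. openin (subtopology X A) T \<and> z \<in> T \<and> T \<subseteq> {z \<in> A. P (f z)}"
      by (intro exI conjI)
  qed
  have o1: "openin (subtopology X A) ?E1" using o[of "\<lambda>v. v = f x"] by simp
  have o2: "openin (subtopology X A) ?E2" using o[of "\<lambda>v. v \<noteq> f x"] by simp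
  have "connected_space (subtopology X A)" and AX: "A \<subseteq> topspace X"
    using assms(1) unfolding connectedin_def by auto
  have ts: "topspace (subtopology X A) = A" using AX by auto
  have "?E1 = {} \<or> ?E2 = {}"
  proof (rule ccontr)
    assume "\<not> ?thesis"
    then have "?E1 \<noteq> {}" "?E2 \<noteq> {}" by blast+
    moreover have "topspace (subtopology X A) \<subseteq> ?E1 \<union> ?E2" "?E1 \<inter> ?E2 = {}"
      unfolding ts by blast+
    ultimately have "\<not> connected_space (subtopology X A)"
      unfolding connected_space_def not_not using o1 o2 by (intro exI conjI)
    then show False using \<open>connected_space (subtopology X A)\<close> by contradiction
  qed
  moreover have "x \<in> ?E1" using assms(3) by simp
  ultimately have "?E2 = {}" by (metis (no_types) empty_iff)
  then have "y \<notin> ?E2" by (simp only: empty_iff not_False_eq_True)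
  then show ?thesis using assms(4) by simp
qed

section \<open>Gluing sections over the unit square\<close>

text \<open>The covering is encoded by a family \<open>a\<close> of functions, of which only the germ of
  \<open>a m\<close> at \<open>m\<close> up to a constant matters.\<close>

definition has_section where
  "has_section a R \<longleftrightarrow> (\<exists>f. \<forall>m\<in>R. coherent_at (top_of_set R) m f (a m))"

lemma has_section_subset:
  assumes "has_section a R" "S \<subseteq> R"
  shows "has_section a S"
proof -
  obtain f where f: "\<And>m. m\<in>R \<Longrightarrow> coherent_at (top_of_set R) m f (a m)"
    using assms(1) unfolding has_section_def by blast
  have "coherent_at (top_of_set S) m f (a m)" if "m \<in> S" for m
    using coherent_at_subtopology[OF f[of m], of S] that assms(2)
    by (auto simp: subtopology_subtopology Int_absorb1)
  then show ?thesis unfolding has_section_def by blast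
qed

text \<open>On the overlap the two local solutions differ by a locally constant, hence constant, sign,
  which can be absorbed into one of them.\<close>

lemma has_section_Un:
  assumes "has_section a R" "has_section a S" "closed R" "closed S" "connected (R \<inter> S)"
  shows "has_section a (R \<union> S)"
proof -
  obtain f where f: "\<And>m. m\<in>R \<Longrightarrow> coherent_at (top_of_set R) m f (a m)"
    using assms(1) unfolding has_section_def by blast
  obtain g where g: "\<And>m. m\<in>S \<Longrightarrow> coherent_at (top_of_set S) m g (a m)"
    using assms(2) unfolding has_section_def by blast
  let ?L = "R \<inter> S"
  have fg: "coherent_at (top_of_set ?L) m f g" if "m \<in> ?L" for m
  proof -
    have "coherent_at (top_of_set ?L) m f (a m)" and g: "coherent_at (top_of_set ?L) m g (a m)"
      using coherent_at_subtopology[OF f[of m], of ?L] coherent_at_subtopology[OF g[of m], of ?L] that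
      by (auto simp: subtopology_subtopology Int_absorb1)
    from this(1) coherent_at_sym[OF g] show ?thesis by (rule coherent_at_trans)
  qed
  have const: "(f x = g x) = (f y = g y)" if "x \<in> ?L" "y \<in> ?L" for x y
  proof (rule connectedin_locally_constant[of euclidean ?L "\<lambda>x. f x = g x"])
    show "connectedin euclidean ?L" using assms(5) by simp
    show "\<exists>T. openin (top_of_set ?L) T \<and> z \<in> T \<and> (\<forall>y\<in>T. (f y = g y) = (f z = g z))"
      if z: "z \<in> ?L" for z
    proof -
      obtain T where T: "openin (top_of_set ?L) T" "z \<in> T" "\<forall>y\<in>T. (f y = f z) = (g y = g z)"
        using fg[OF z] unfolding coherent_at_def by (elim exE conjE)
      have "\<forall>y\<in>T. (f y = g y) = (f z = g z)"
      proof
        fix y assume "y \<in> T"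
        with T(3) have "(f y = f z) = (g y = g z)" by (rule bspec)
        then show "(f y = g y) = (f z = g z)" by argo
      qed
      with T(1,2) show ?thesis by (intro exI conjI)
    qed
  qed (use that in auto)
  \<comment> \<open>The sign is read off at an arbitrary point of the overlap; if the overlap is
    empty, the claim is vacuous.\<close>
  obtain e where e: "\<And>x. x \<in> ?L \<Longrightarrow> (f x = (g x = e))"
  proof
    fix x assume x: "x \<in> ?L"
    let ?z = "SOME z. z \<in> ?L"
    have "?z \<in> ?L" using x by (rule someI)
    from const[OF x this] show "f x = (g x = (f ?z = g ?z))" by blast
  qed
  define k where "k x = (if x \<in> R then f x else (g x = e))" for x
  have kR: "k x = f x" if "x \<in> R" for x using that by (simp add: k_def)
  have kS: "k x = (g x = e)" if "x \<in> S" for x using that e by (auto simp: k_def)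
  have "coherent_at (top_of_set (R \<union> S)) m k (a m)" if m: "m \<in> R \<union> S" for m
  proof -
    \<comment> \<open>Here closedness enters: a point outside \<open>R\<close> has a neighbourhood
      missing \<open>R\<close>, where nothing is to be checked. The same is done for
      \<open>S\<close> next, and the two neighbourhoods are intersected.\<close>
    have 1: "\<exists>V. open V \<and> m \<in> V \<and> (\<forall>x\<in>V \<inter> R. (k x = k m) = (a m x = a m m))"
    proof (cases "m \<in> R")
      case True
      then obtain W where W: "openin (top_of_set R) W" "m \<in> W" "\<forall>x\<in>W. (f x = f m) = (a m x = a m m)"
        using f unfolding coherent_at_def by blast
      then obtain V where "open V" "W = R \<inter> V" unfolding openin_open by blast
      then show ?thesis using W True kR by (intro exI[of _ V]) auto
    next
      case False
      then show ?thesis using assms(3) by (intro exI[of _ "- R"]) auto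
    qed
    have 2: "\<exists>V. open V \<and> m \<in> V \<and> (\<forall>x\<in>V \<inter> S. (k x = k m) = (a m x = a m m))"
    proof (cases "m \<in> S")
      case True
      then obtain W where W: "openin (top_of_set S) W" "m \<in> W" "\<forall>x\<in>W. (g x = g m) = (a m x = a m m)"
        using g unfolding coherent_at_def by blast
      then obtain V where "open V" "W = S \<inter> V" unfolding openin_open by blast
      then show ?thesis using W True kS by (intro exI[of _ V]) auto
    next
      case False
      then show ?thesis using assms(4) by (intro exI[of _ "- S"]) auto
    qed
    obtain V where V: "open V" "m \<in> V" "\<forall>x\<in>V \<inter> R. (k x = k m) = (a m x = a m m)"
      using 1 by (elim exE conjE)
    obtain V' where V': "open V'" "m \<in> V'" "\<forall>x\<in>V' \<inter> S. (k x = k m) = (a m x = a m m)"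
      using 2 by (elim exE conjE)
    have "(k x = k m) = (a m x = a m m)" if "x \<in> (R \<union> S) \<inter> (V \<inter> V')" for x
    proof (cases "x \<in> R")
      case True
      then show ?thesis using that by (intro bspec[OF V(3)]) blast
    next
      case False
      then show ?thesis using that by (intro bspec[OF V'(3)]) blast
    qed
    moreover have "openin (top_of_set (R \<union> S)) ((R \<union> S) \<inter> (V \<inter> V'))"
      using V(1) V'(1) by (intro openin_open_Int open_Int)
    moreover have "m \<in> (R \<union> S) \<inter> (V \<inter> V')" using m V(2) V'(2) by blast
    ultimately show ?thesis
      unfolding coherent_at_def by blast
  qed
  then show ?thesis unfolding has_section_def by blast
qed

text \<open>Compactness enters through bisection, once in each coordinate: small boxes are glued
  vertically into thin strips of full height, and the strips horizontally into the square. All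
  pieces are rectangles, so the overlaps are convex and therefore connected, as gluing
  requires.\<close>

lemma has_section_square:
  fixes a :: "real \<times> real \<Rightarrow> real \<times> real \<Rightarrow> bool"
  assumes loc: "\<And>q. q \<in> {0..1} \<times> {0..1} \<Longrightarrow>
     \<exists>V. open V \<and> q \<in> V \<and> has_section a (V \<inter> {0..1} \<times> {0..1})"
  shows "has_section a ({0..1} \<times> {0..1})"
proof -
  define G where "G R \<longleftrightarrow> has_section a (R \<inter> {0..1} \<times> {0..1})" for R
  have box: "\<exists>d>0. \<forall>l u b t. l \<le> x \<and> x \<le> u \<and> u - l < d \<and> b \<le> y \<and> y \<le> t \<and> t - b < d \<longrightarrow> G ({l..u} \<times> {b..t})"
    if xy: "x \<in> {0..1}" "y \<in> {0..1}" for x y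
  proof -
    obtain V where V: "open V" "(x,y) \<in> V" "has_section a (V \<inter> {0..1} \<times> {0..1})"
      using loc[OF SigmaI[OF xy]] by (elim exE conjE)
    obtain A B where AB: "open A" "open B" "x \<in> A" "y \<in> B" "A \<times> B \<subseteq> V"
      using open_prod_elim[OF V(1,2)] by (metis mem_Sigma_iff)
    obtain d1 where d1: "d1 > 0" "ball x d1 \<subseteq> A" using AB open_contains_ball by blast
    obtain d2 where d2: "d2 > 0" "ball y d2 \<subseteq> B" using AB open_contains_ball by blast
    show ?thesis
    proof (intro exI[of _ "min d1 d2"] conjI allI impI)
      fix l u b t
      assume *: "l \<le> x \<and> x \<le> u \<and> u - l < min d1 d2 \<and> b \<le> y \<and> y \<le> t \<and> t - b < min d1 d2"
      have "{l..u} \<subseteq> ball x d1" "{b..t} \<subseteq> ball y d2"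
        using * by (auto simp: dist_real_def)
      then have "{l..u} \<times> {b..t} \<subseteq> V" using AB d1 d2 by blast
      then have "{l..u} \<times> {b..t} \<inter> {0..1} \<times> {0..1} \<subseteq> V \<inter> {0..1} \<times> {0..1}"
        by (rule Int_mono) (rule order_refl)
      then show "G ({l..u} \<times> {b..t})"
        unfolding G_def by (rule has_section_subset[OF V(3)])
    qed (use d1 d2 in auto)
  qed
  have glue: "G (R \<union> S)" if "G R" "G S" "closed R" "closed S" "convex (R \<inter> S)" for R S
  proof -
    have "convex (R \<inter> S \<inter> {0..1} \<times> {0..1::real})"
      by (rule convex_Int[OF that(5)]) (intro convex_Times convex_real_interval)
    moreover have "R \<inter> {0..1} \<times> {0..1} \<inter> (S \<inter> {0..1} \<times> {0..1}) = R \<inter> S \<inter> {0..1} \<times> {0..1}"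
      by blast
    ultimately have "connected (R \<inter> {0..1} \<times> {0..1} \<inter> (S \<inter> {0..1} \<times> {0..1}))"
      using convex_connected by simp
    moreover have "closed (R \<inter> {0..1} \<times> {0..1})" "closed (S \<inter> {0..1} \<times> {0..1})"
      by (intro closed_Int closed_Times that closed_atLeastAtMost)+
    ultimately show ?thesis
      using has_section_Un[of a "R \<inter> {0..1} \<times> {0..1}" "S \<inter> {0..1} \<times> {0..1}"] that
      unfolding G_def by (simp add: Int_Un_distrib2)
  qed
  have cl: "closed ({l..u} \<times> {b..t})" for l u b t :: real
    by (intro closed_Times closed_atLeastAtMost)
  have cv: "convex ({l..u} \<times> {b..t} \<inter> {l'..u'} \<times> {b'..t'})" for l u b t l' u' b' t' :: real
    by (intro convex_Int convex_Times convex_real_interval)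
  \<comment> \<open>The bound on the width is part of the bisected property, so that a vertical
    gluing can pass to the smaller of two widths.\<close>
  have strip: "\<exists>d>0. \<forall>l u. l \<le> x \<and> x \<le> u \<and> u - l < d \<longrightarrow> G ({l..u} \<times> {0..1})" if x: "x \<in> {0..1}" for x
  proof (rule Bolzano[where P = "\<lambda>b t. \<exists>d>0. \<forall>l u. l \<le> x \<and> x \<le> u \<and> u - l < d \<longrightarrow> G ({l..u} \<times> {b..t})"])
    fix b c t :: real
    assume "\<exists>d>0. \<forall>l u. l \<le> x \<and> x \<le> u \<and> u - l < d \<longrightarrow> G ({l..u} \<times> {b..c})"
      "\<exists>d>0. \<forall>l u. l \<le> x \<and> x \<le> u \<and> u - l < d \<longrightarrow> G ({l..u} \<times> {c..t})" and le: "b \<le> c" "c \<le> t"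
    then obtain d e where d: "d > 0" "\<forall>l u. l \<le> x \<and> x \<le> u \<and> u - l < d \<longrightarrow> G ({l..u} \<times> {b..c})"
      and e: "e > 0" "\<forall>l u. l \<le> x \<and> x \<le> u \<and> u - l < e \<longrightarrow> G ({l..u} \<times> {c..t})" by blast
    have "G ({l..u} \<times> {b..t})" if "l \<le> x" "x \<le> u" "u - l < min d e" for l u
    proof -
      have "{l..u} \<times> {b..t} = {l..u} \<times> {b..c} \<union> {l..u} \<times> {c..t}" using le by auto
      moreover have "G ({l..u} \<times> {b..c})" "G ({l..u} \<times> {c..t})" using d e that by auto
      ultimately show ?thesis using glue[OF _ _ cl cl cv] by metis
    qed
    then show "\<exists>d>0. \<forall>l u. l \<le> x \<and> x \<le> u \<and> u - l < d \<longrightarrow> G ({l..u} \<times> {b..t})"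
      using d(1) e(1) by (intro exI[of _ "min d e"]) auto
  next
    fix y :: real assume "0 \<le> y" "y \<le> 1"
    then obtain d where "d > 0" "\<forall>l u b t. l \<le> x \<and> x \<le> u \<and> u - l < d \<and> b \<le> y \<and> y \<le> t \<and> t - b < d \<longrightarrow> G ({l..u} \<times> {b..t})"
      using box[OF x, of y] by auto
    then show "\<exists>d>0. \<forall>b t. b \<le> y \<and> y \<le> t \<and> t - b < d \<longrightarrow>
        (\<exists>d>0. \<forall>l u. l \<le> x \<and> x \<le> u \<and> u - l < d \<longrightarrow> G ({l..u} \<times> {b..t}))"
      by blast
  qed simp
  have "G ({0..1} \<times> {0..1})"
  proof (rule Bolzano[where P = "\<lambda>l u. G ({l..u} \<times> {0..1})"])
    fix l c u :: real
    assume "G ({l..c} \<times> {0..1})" "G ({c..u} \<times> {0..1})" and le: "l \<le> c" "c \<le> u"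
    moreover have "{l..u} \<times> {0..1::real} = {l..c} \<times> {0..1} \<union> {c..u} \<times> {0..1}" using le by auto
    ultimately show "G ({l..u} \<times> {0..1})" using glue[OF _ _ cl cl cv] by metis
  qed (use strip in auto)
  then show ?thesis unfolding G_def by simp
qed

section \<open>Convexity in Euclidean space\<close>

lemma Euclidean_space_convex_neighbourhood:
  assumes "openin (Euclidean_space n) S" "x \<in> S"
  obtains B where "openin (Euclidean_space n) B" "x \<in> B" "B \<subseteq> S"
    "\<And>u v t. u \<in> B \<Longrightarrow> v \<in> B \<Longrightarrow> 0 \<le> t \<Longrightarrow> t \<le> 1 \<Longrightarrow> (\<lambda>i. (1-t) * u i + t * v i) \<in> B"
proof -
  let ?N = "{x::nat\<Rightarrow>real. \<forall>i\<ge>n. x i = 0}"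
  obtain T where T: "openin (powertop_real UNIV) T" "S = T \<inter> ?N"
    using assms(1) unfolding Euclidean_space_def openin_subtopology by blast
  obtain U where U: "finite {i. U i \<noteq> UNIV}" "\<And>i. open (U i)" "x \<in> Pi\<^sub>E UNIV U" "Pi\<^sub>E UNIV U \<subseteq> T"
    using T assms(2) unfolding openin_product_topology_alt by fastforce
  have "\<exists>e>0. ball (x i) e \<subseteq> U i" for i
    using U(2)[of i] U(3) open_contains_ball by (auto simp: PiE_iff)
  then obtain e where e: "\<And>i. e i > 0" "\<And>i. ball (x i) (e i) \<subseteq> U i" by metis
  \<comment> \<open>Unrestricted factors stay unrestricted, so that only finitely many factors are
    proper and the box is open in the product topology; the others shrink to intervals to become
    convex.\<close>
  define C where "C i = (if U i = UNIV then UNIV else ball (x i) (e i))" for i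
  define B where "B = Pi\<^sub>E UNIV C \<inter> ?N"
  have conv: "convex (C i)" for i by (simp add: C_def)
  have "openin (powertop_real UNIV) (Pi\<^sub>E UNIV C)"
    by (rule product_topology_basis) (auto simp: C_def intro: finite_subset[OF _ U(1)])
  then have 1: "openin (Euclidean_space n) B"
    unfolding B_def Euclidean_space_def openin_subtopology by blast
  have 2: "x \<in> B" using T assms(2) e(1) by (auto simp: B_def C_def)
  have "C i \<subseteq> U i" for i using e(2) by (auto simp: C_def)
  then have "Pi\<^sub>E UNIV C \<subseteq> Pi\<^sub>E UNIV U" by (rule PiE_mono)
  then have 3: "B \<subseteq> S" using U(4) T(2) by (auto simp: B_def)
  have 4: "(\<lambda>i. (1-t) * u i + t * v i) \<in> B" if "u \<in> B" "v \<in> B" "0 \<le> t" "t \<le> 1" for u v t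
  proof -
    have "(1-t) * u i + t * v i \<in> C i" for i
      using conv[of i] that unfolding convex_alt B_def by (auto simp: PiE_iff)
    then show ?thesis using that by (auto simp: B_def)
  qed
  show thesis using that[OF 1 2 3 4] .
qed

lemma connectedin_Euclidean_space_segments:
  assumes sub: "A \<subseteq> topspace (Euclidean_space n)"
    and seg: "\<And>u v t. u \<in> A \<Longrightarrow> v \<in> A \<Longrightarrow> 0 \<le> t \<Longrightarrow> t \<le> 1 \<Longrightarrow> (\<lambda>i. (1-t) * u i + t * v i) \<in> A"
  shows "connectedin (Euclidean_space n) A"
proof (rule path_connectedin_imp_connectedin, unfold path_connectedin, intro conjI ballI sub)
  fix u v assume uv: "u \<in> A" "v \<in> A"
  let ?g = "\<lambda>t::real. \<lambda>i. (1-t) * u i + t * v i"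
  have N: "\<forall>i\<ge>n. ?g t i = 0" for t
    using subsetD[OF sub uv(1)] subsetD[OF sub uv(2)] by (simp add: topspace_Euclidean_space)
  have "continuous_map (top_of_set {0..1}) (powertop_real UNIV) ?g"
    unfolding continuous_map_componentwise_UNIV by (auto intro!: continuous_intros)
  then have "pathin (Euclidean_space n) ?g"
    unfolding pathin_def Euclidean_space_def continuous_map_in_subtopology using N by auto
  then show "\<exists>g. pathin (Euclidean_space n) g \<and> g \<in> {0..1} \<rightarrow> A \<and> g 0 = u \<and> g 1 = v"
    using seg[OF uv] by (intro exI[of _ ?g]) auto
qed

section \<open>The two-sheeted covering of an atlas of sides\<close>

text \<open>\<open>s y\<close> names the two sides of \<open>H\<close> inside \<open>U y\<close>,
  and only its values off \<open>H\<close> count. \<open>compatible\<close> says that the transition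
  signs are locally constant, \<open>dense\<close> that these signs are determined by the labels off
  \<open>H\<close>, and \<open>side_off\<close> supplies the canonical section over the
  complement.\<close>

locale side_atlas =
  fixes M :: "'a topology" and H :: "'a set" and U :: "'a \<Rightarrow> 'a set" and s :: "'a \<Rightarrow> 'a \<Rightarrow> bool"
  assumes open_U: "y \<in> topspace M \<Longrightarrow> openin M (U y)"
    and mem_U: "y \<in> topspace M \<Longrightarrow> y \<in> U y"
    and compatible: "\<lbrakk>y \<in> topspace M; z \<in> topspace M; m \<in> U y; m \<in> U z\<rbrakk> \<Longrightarrow>
      \<exists>W. openin M W \<and> m \<in> W \<and> ((\<forall>x\<in>W - H. s y x = s z x) \<or> (\<forall>x\<in>W - H. s y x \<noteq> s z x))"
    and dense: "\<lbrakk>openin M W; m \<in> W\<rbrakk> \<Longrightarrow> W - H \<noteq> {}"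
    and open_complement: "openin M (topspace M - H)"
    and side_off: "\<lbrakk>y \<in> topspace M - H; x \<in> topspace M - H\<rbrakk> \<Longrightarrow> s y x"
begin

text \<open>The labelling of sides by \<open>s y\<close>, read off at \<open>m\<close> relative to the
  reference labelling \<open>s m\<close>; this also makes sense for \<open>m\<close> on the hypersurface.\<close>

definition sheet :: "'a \<Rightarrow> 'a \<Rightarrow> bool" where
  "sheet y m \<longleftrightarrow> (\<exists>W. openin M W \<and> m \<in> W \<and> (\<forall>x\<in>W - H. s y x = s m x))"

text \<open>Two neighbourhoods of \<open>m\<close> share a point off \<open>H\<close>, by density,
  and there the labels cannot both agree and differ. Thus the relative sign at \<open>m\<close> is
  well defined.\<close>

lemma not_sheetI:
  assumes "openin M W" "m \<in> W" "\<forall>x\<in>W - H. s y x \<noteq> s m x"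
  shows "\<not> sheet y m"
proof
  assume "sheet y m"
  then obtain V where V: "openin M V" "m \<in> V" "\<forall>x\<in>V - H. s y x = s m x"
    unfolding sheet_def by (elim exE conjE)
  have "W \<inter> V - H \<noteq> {}"
    using dense[of "W \<inter> V" m] assms V by (simp add: openin_Int)
  then obtain x where x: "x \<in> W - H" "x \<in> V - H" by blast
  show False using bspec[OF assms(3) x(1)] bspec[OF V(3) x(2)] by contradiction
qed

text \<open>Folds both alternatives of \<open>compatible\<close> into one equation of truth values,
  so that signs can be compared by propositional reasoning at a point off \<open>H\<close>.\<close>

lemma sheet_cases:
  assumes "y \<in> topspace M" "m \<in> U y"
  obtains W where "openin M W" "m \<in> W" "\<forall>x\<in>W - H. (s y x = s m x) = sheet y m"
proof -
  have m: "m \<in> topspace M" using openin_subset[OF open_U[OF assms(1)]] assms(2) by blast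
  obtain W where W: "openin M W" "m \<in> W"
    "(\<forall>x\<in>W - H. s y x = s m x) \<or> (\<forall>x\<in>W - H. s y x \<noteq> s m x)"
    using compatible[OF assms(1) m assms(2) mem_U[OF m]] by (elim exE conjE)
  from W(3) show thesis
  proof (elim disjE)
    assume *: "\<forall>x\<in>W - H. s y x = s m x"
    then have "sheet y m" using W unfolding sheet_def by blast
    then show thesis using that[OF W(1,2)] * by simp
  next
    assume *: "\<forall>x\<in>W - H. s y x \<noteq> s m x"
    then have "\<not> sheet y m" using W not_sheetI by simp
    then show thesis using that[OF W(1,2)] * by simp
  qed
qed

text \<open>The cocycle rule for signs: near \<open>m\<close> the sign \<open>e\<close> between
  \<open>s y\<close> and \<open>s m\<close> is fixed, and at each nearby \<open>x\<close> it is the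
  product of their signs relative to \<open>s x\<close>. So \<open>sheet y\<close> is a section of
  the covering over all of \<open>U y\<close>.\<close>

lemma sheet_coherent:
  assumes y: "y \<in> topspace M" and m: "m \<in> U y"
  shows "coherent_at M m (sheet y) (sheet m)"
proof -
  have mM: "m \<in> topspace M" using openin_subset[OF open_U[OF y]] m by blast
  obtain e W where W: "openin M W" "m \<in> W" "\<forall>x\<in>W - H. (s y x = s m x) = e"
    using sheet_cases[OF y m] by metis
  let ?V = "W \<inter> U y \<inter> U m"
  have V: "openin M ?V" "m \<in> ?V" using W open_U mem_U y m mM by auto
  have key: "(sheet y x = sheet m x) = e" if x: "x \<in> ?V" for x
  proof -
    obtain A where A: "openin M A" "x \<in> A" "\<forall>z\<in>A - H. (s y z = s x z) = sheet y x"
      using sheet_cases[OF y, of x] x by blast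
    obtain B where B: "openin M B" "x \<in> B" "\<forall>z\<in>B - H. (s m z = s x z) = sheet m x"
      using sheet_cases[OF mM, of x] x by blast
    \<comment> \<open>A point off \<open>H\<close> at which the three pairwise comparisons of
      \<open>s y\<close>, \<open>s m\<close> and \<open>s x\<close> hold simultaneously.\<close>
    have "?V \<inter> A \<inter> B - H \<noteq> {}"
      by (rule dense[of _ x]) (use A B V x in auto)
    then obtain z where z: "z \<in> W - H" "z \<in> A - H" "z \<in> B - H" by blast
    show ?thesis using bspec[OF W(3) z(1)] bspec[OF A(3) z(2)] bspec[OF B(3) z(3)] by argo
  qed
  have "(sheet y x = sheet y m) = (sheet m x = sheet m m)" if "x \<in> ?V" for x
    using key[OF that] key[OF V(2)] by argo
  then show ?thesis unfolding coherent_at_def using V by blast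
qed

text \<open>The canonical section: off \<open>H\<close> all reference labels are true, so all signs
  between them are trivial.\<close>

lemma sheet_off:
  assumes "y \<in> topspace M - H" "m \<in> topspace M - H"
  shows "sheet y m"
  unfolding sheet_def
  by (intro exI[of _ "topspace M - H"] conjI ballI open_complement)
    (use side_off assms in auto)

text \<open>Off \<open>H\<close> the reference label \<open>s m m\<close> is true, so the sign
  relative to it is the label itself. This turns a change of side into a change of sheet.\<close>

lemma sheet_eq_side:
  assumes "p \<in> topspace M" "m \<in> U p" "m \<notin> H"
  shows "sheet p m = s p m"
proof -
  have "m \<in> topspace M - H"
    using openin_subset[OF open_U[OF assms(1)]] assms by blast
  then have sm: "s m m" by (simp add: side_off)
  obtain W where W: "m \<in> W" "\<forall>x\<in>W - H. (s p x = s m x) = sheet p m"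
    using sheet_cases[OF assms(1,2)] by metis
  have "m \<in> W - H" using W(1) assms(3) by simp
  from bspec[OF W(2) this] sm show ?thesis by simp
qed

text \<open>The pullback of the covering along \<open>h\<close> is trivial over the preimage of each
  \<open>U (h q)\<close>, where \<open>sheet (h q)\<close> composed with \<open>h\<close> is a
  section; these local sections are glued over the square.\<close>

lemma section_on_square:
  assumes h: "continuous_map (top_of_set ({0..1} \<times> {0..1})) M h"
  obtains \<sigma> :: "real \<times> real \<Rightarrow> bool"
  where "\<And>q. q \<in> {0..1} \<times> {0..1} \<Longrightarrow>
    coherent_at (top_of_set ({0..1} \<times> {0..1})) q \<sigma> (sheet (h q) \<circ> h)"
proof -
  let ?Q = "{0..1} \<times> {0..1} :: (real \<times> real) set"
  have hM: "h q \<in> topspace M" if "q \<in> ?Q" for q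
    using continuous_map_funspace[OF h] that by auto
  have "has_section (\<lambda>q. sheet (h q) \<circ> h) ?Q"
  proof (rule has_section_square)
    fix q assume q: "q \<in> ?Q"
    have "openin (top_of_set ?Q) {x \<in> ?Q. h x \<in> U (h q)}"
      using openin_continuous_map_preimage[OF h open_U[OF hM[OF q]]] by simp
    then obtain V where V: "open V" "{x \<in> ?Q. h x \<in> U (h q)} = ?Q \<inter> V"
      unfolding openin_open by blast
    have "coherent_at (top_of_set (V \<inter> ?Q)) m (sheet (h q) \<circ> h) (sheet (h m) \<circ> h)"
      if m: "m \<in> V \<inter> ?Q" for m
    proof (rule coherent_at_compose)
      show "coherent_at M (h m) (sheet (h q)) (sheet (h m))"
        by (rule sheet_coherent) (use hM q m V in auto)
      show "continuous_map (top_of_set (V \<inter> ?Q)) M h"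
        using h by (rule continuous_map_from_subtopology_mono) simp
    qed (use m in simp)
    moreover have "q \<in> V" using V(2) q mem_U hM by blast
    ultimately show "\<exists>V. open V \<and> q \<in> V \<and> has_section (\<lambda>q. sheet (h q) \<circ> h) (V \<inter> ?Q)"
      using V(1) unfolding has_section_def by blast
  qed
  then show thesis using that unfolding has_section_def by blast
qed

text \<open>Along \<open>A\<close> the reference functions coincide with the canonical section,
  which is constantly true, so \<open>\<sigma>\<close> is locally constant there.\<close>

lemma section_constant:
  assumes h: "continuous_map (top_of_set Q) M h"
    and \<sigma>: "\<And>q. q \<in> Q \<Longrightarrow> coherent_at (top_of_set Q) q \<sigma> (sheet (h q) \<circ> h)"
    and A: "connected A" "A \<subseteq> Q" "\<And>q. q \<in> A \<Longrightarrow> h q \<notin> H" and xy: "x \<in> A" "y \<in> A"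
  shows "\<sigma> x = \<sigma> y"
proof (rule connectedin_locally_constant[of euclidean A])
  fix z assume z: "z \<in> A"
  have hM: "h q \<in> topspace M - H" if "q \<in> A" for q
    using continuous_map_funspace[OF h] that A by auto
  have "coherent_at (top_of_set A) z \<sigma> (sheet (h z) \<circ> h)"
    using coherent_at_subtopology[OF \<sigma> z] z A(2)
    by (auto simp: subtopology_subtopology Int_absorb1)
  then obtain T where T: "openin (top_of_set A) T" "z \<in> T"
    "\<forall>x\<in>T. (\<sigma> x = \<sigma> z) = ((sheet (h z) \<circ> h) x = (sheet (h z) \<circ> h) z)"
    unfolding coherent_at_def by (elim exE conjE)
  have "\<sigma> x = \<sigma> z" if x: "x \<in> T" for x
  proof -
    have "x \<in> A" using openin_subset[OF T(1)] x by auto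
    then have "sheet (h z) (h x)" "sheet (h z) (h z)" using sheet_off hM z by blast+
    then show ?thesis using bspec[OF T(3) x] by simp
  qed
  then show "\<exists>T. openin (top_of_set A) T \<and> z \<in> T \<and> (\<forall>y\<in>T. \<sigma> y = \<sigma> z)"
    using T(1,2) by blast
qed (use A xy in auto)

text \<open>A section over the square is compared just before and just after the crossing. Going
  around the rest of the boundary gives equal values, going through the crossing gives different
  ones.\<close>

lemma single_crossing_not_null_homotopic:
  assumes hom: "homotopic_with (\<lambda>r. r 0 = b \<and> r 1 = b) (top_of_set {0..1::real}) M g (\<lambda>_. b)"
    and b: "b \<notin> H" and c: "0 < c" "c < 1"
    and off: "\<And>t. 0 \<le> t \<Longrightarrow> t \<le> 1 \<Longrightarrow> t \<noteq> c \<Longrightarrow> g t \<notin> H"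
    and cross: "0 < d" "\<And>t. 0 \<le> t \<Longrightarrow> t \<le> 1 \<Longrightarrow> \<bar>t - c\<bar> < d \<Longrightarrow> g t \<in> U (g c) \<and> (t \<noteq> c \<longrightarrow> s (g c) (g t) = (c < t))"
  shows False
proof -
  let ?Q = "{0..1} \<times> {0..1} :: (real \<times> real) set"
  obtain h where "continuous_map (prod_topology (top_of_set {0..1::real}) (top_of_set {0..1::real})) M h"
    and h0: "\<forall>t. h (0, t) = g t" and h1: "\<forall>t. h (1, t) = b"
    and hb: "\<forall>r\<in>{0..1}. h (r, 0) = b \<and> h (r, 1) = b"
    using hom unfolding homotopic_with_def by (elim exE conjE)
  then have h: "continuous_map (top_of_set ?Q) M h" by simp
  obtain \<sigma> :: "real \<times> real \<Rightarrow> bool"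
    where \<sigma>: "\<And>q. q \<in> ?Q \<Longrightarrow> coherent_at (top_of_set ?Q) q \<sigma> (sheet (h q) \<circ> h)"
    using section_on_square[OF h] by blast
  \<comment> \<open>The boundary of the square without \<open>(0, c)\<close>. The first coordinate
    is the homotopy parameter, so the loop runs along the edge over \<open>0\<close> and the other
    three edges are sent to \<open>b\<close>. Successive pieces share a corner.\<close>
  define A :: "(real \<times> real) set" where "A = (({0} \<times> {0..<c} \<union> {0..1} \<times> {0}) \<union> {1} \<times> {0..1}) \<union> ({0..1} \<times> {1} \<union> {0} \<times> {c<..1})"
  have connTimes: "connected (S \<times> T)" if "convex S" "convex T" for S T :: "real set"
    using that by (intro convex_connected convex_Times)
  have join: "connected (S \<union> T)" if "connected S" "connected T" "x \<in> S" "x \<in> T"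
    for S T :: "(real \<times> real) set" and x
    using that by (intro connected_Un) auto
  have A: "connected A" unfolding A_def
    by (rule join[of _ _ "(1,1)"], rule join[of _ _ "(1,0)"], rule join[of _ _ "(0,0)"])
      (use c in \<open>auto intro!: connTimes join[of _ _ "(0,1)"]\<close>)
  have AQ: "A \<subseteq> ?Q" using c by (auto simp: A_def)
  have AH: "h q \<notin> H" if "q \<in> A" for q
    using that off b c unfolding A_def by (auto simp: h0 h1 hb)
  have q: "(0, c) \<in> ?Q" using c by simp
  have pM: "g c \<in> topspace M" using funcset_mem[OF continuous_map_funspace[OF h], of "(0, c)"] c h0 by simp
  obtain W where W: "openin (top_of_set ?Q) W" "(0,c) \<in> W"
    "\<forall>x\<in>W. (\<sigma> x = \<sigma> (0,c)) = ((sheet (h (0,c)) \<circ> h) x = (sheet (h (0,c)) \<circ> h) (0,c))"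
    using \<sigma>[OF q] unfolding coherent_at_def by (elim exE conjE)
  obtain e where e: "e > 0" "\<And>x. x \<in> ?Q \<Longrightarrow> dist x (0,c) < e \<Longrightarrow> x \<in> W"
    using W(1,2) unfolding openin_euclidean_subtopology_iff by blast
  \<comment> \<open>Small enough that \<open>c - r\<close> and \<open>c + r\<close> stay in the unit
    interval, in the range where the side of \<open>g t\<close> is known, and in
    \<open>W\<close>.\<close>
  define r where "r = min (min d e) (min c (1 - c)) / 2"
  have r: "0 < r" "r < d" "r < e" "r < c" "r < 1 - c" using c cross(1) e(1) by (auto simp: r_def)
  have "\<sigma> (0, c - r) = \<sigma> (0, c + r)"
    by (rule section_constant[OF h \<sigma> A AQ AH]) (use r in \<open>auto simp: A_def\<close>)
  \<comment> \<open>Whatever the value of \<open>sheet (g c) (g c)\<close>, exactly one of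
    \<open>c - r\<close> and \<open>c + r\<close> gives the same value of \<open>\<sigma>\<close> as
    \<open>c\<close>, contradicting the equality just obtained.\<close>
  moreover have "(\<sigma> (0,t) = \<sigma> (0,c)) = ((c < t) = sheet (g c) (g c))" if "t = c - r \<or> t = c + r" for t
  proof -
    have t: "0 \<le> t" "t \<le> 1" "\<bar>t - c\<bar> < d" "t \<noteq> c" "\<bar>t - c\<bar> < e" using that r by auto
    have "(0,t) \<in> W" using t by (intro e(2)) (auto simp: dist_Pair_Pair dist_real_def)
    from bspec[OF W(3) this]
    have "(\<sigma> (0,t) = \<sigma> (0,c)) = (sheet (g c) (g t) = sheet (g c) (g c))" by (simp add: h0)
    moreover have "sheet (g c) (g t) = (c < t)"
      using sheet_eq_side[OF pM, of "g t"] off cross(2) t by simp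
    ultimately show ?thesis by simp
  qed
  from this[of "c - r"] this[of "c + r"]
  have "(\<sigma> (0, c - r) = \<sigma> (0,c)) = (False = sheet (g c) (g c))" "(\<sigma> (0, c + r) = \<sigma> (0,c)) = (True = sheet (g c) (g c))"
    using r(1) by auto
  ultimately show False by argo
qed

end

section \<open>Local structure of a manifold and of a flat chart\<close>

text \<open>Serves to turn connectedness of the open complement of \<open>H\<close> into
  path-connectedness.\<close>

lemma locally_path_connected_space_manifold:
  assumes "manifold n M"
  shows "locally_path_connected_space M"
  unfolding locally_path_connected_space
proof (intro allI impI)
  fix V x assume V: "openin M V \<and> x \<in> V"
  then have "x \<in> topspace M" using openin_subset by blast
  then obtain U where U: "openin M U" "x \<in> U" "subtopology M U homeomorphic_space Euclidean_space n"
    using assms unfolding manifold_def by blast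
  have "locally_path_connected_space (subtopology M U)"
    using homeomorphic_locally_path_connected_space[OF U(3)] locally_path_connected_Euclidean_space by blast
  moreover have "openin (subtopology M U) (V \<inter> U)" "x \<in> V \<inter> U"
    using V U by (auto simp: openin_open_subtopology)
  ultimately obtain W where "openin (subtopology M U) W" "path_connectedin (subtopology M U) W"
    "x \<in> W" "W \<subseteq> V \<inter> U"
    unfolding locally_path_connected_space by metis
  then show "\<exists>W. openin M W \<and> path_connectedin M W \<and> x \<in> W \<and> W \<subseteq> V"
    using U(1) by (intro exI[of _ W]) (auto simp: openin_open_subtopology path_connectedin_subtopology)
qed

text \<open>No centre is fixed, because charts get compared at points of \<open>H\<close> that need
  not be the centre of either.\<close>

locale flat_chart =
  fixes n :: nat and M :: "'a topology" and H U :: "'a set" and f :: "'a \<Rightarrow> nat \<Rightarrow> real"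
  assumes n: "n \<ge> 1" and open_U: "openin M U"
    and homeo: "homeomorphic_map (subtopology M U) (Euclidean_space n) f"
    and flat: "f ` (U \<inter> H) = {x \<in> topspace (Euclidean_space n). x (n - 1) = 0}"
begin

lemma topspace_U: "topspace (subtopology M U) = U"
  using openin_subset[OF open_U] by auto

lemma in_hypersurface_iff:
  assumes "x \<in> U"
  shows "x \<in> H \<longleftrightarrow> f x (n - 1) = 0"
proof
  assume "f x (n - 1) = 0"
  moreover have "f x \<in> topspace (Euclidean_space n)"
    using homeomorphic_imp_surjective_map[OF homeo] assms topspace_U by blast
  ultimately have "f x \<in> f ` (U \<inter> H)" using flat by blast
  then show "x \<in> H"
    using homeomorphic_imp_injective_map[OF homeo] assms unfolding topspace_U inj_on_def by blast
qed (use flat assms in blast)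

lemma continuous_coordinate: "continuous_map (subtopology M U) euclideanreal (\<lambda>x. f x i)"
proof -
  have "continuous_map (subtopology M U) (powertop_real UNIV) f"
    using homeomorphic_imp_continuous_map[OF homeo]
    unfolding Euclidean_space_def continuous_map_in_subtopology by blast
  then show ?thesis unfolding continuous_map_componentwise_UNIV by blast
qed

lemma openin_coordinate:
  assumes "open T"
  shows "openin M {x \<in> U. f x i \<in> T}"
proof (rule openin_trans_full[OF _ open_U])
  show "openin (subtopology M U) {x \<in> U. f x i \<in> T}"
    using openin_continuous_map_preimage[OF continuous_coordinate, of T i] assms
    unfolding topspace_U by simp
qed

text \<open>In the chart, a convex neighbourhood of \<open>f m\<close> is cut by the hyperplane into
  two convex halves, and the normal line through \<open>f m\<close> meets both. Connected halves
  force the label of any other chart to be constant on each of them.\<close>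

lemma two_sided_neighbourhood:
  assumes V: "openin M V" "m \<in> V" and m: "m \<in> U" "m \<in> H"
  obtains W where "openin M W" "m \<in> W" "W \<subseteq> V" "W \<subseteq> U"
    "connectedin M {x \<in> W - H. f x (n - 1) > 0}" "connectedin M {x \<in> W - H. \<not> f x (n - 1) > 0}"
    "{x \<in> W - H. f x (n - 1) > 0} \<noteq> {}" "{x \<in> W - H. \<not> f x (n - 1) > 0} \<noteq> {}"
proof -
  let ?E = "Euclidean_space n"
  obtain g where g: "homeomorphic_maps (subtopology M U) ?E f g"
    using homeo unfolding homeomorphic_map_maps by blast
  have gf: "g (f x) = x" if "x \<in> U" for x
    using g that topspace_U unfolding homeomorphic_maps_def by blast
  have fg: "f (g y) = y" if "y \<in> topspace ?E" for y
    using g that unfolding homeomorphic_maps_def by blast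
  have cg: "continuous_map ?E (subtopology M U) g"
    using g unfolding homeomorphic_maps_def by blast
  have gU: "g y \<in> U" if "y \<in> topspace ?E" for y
    using continuous_map_funspace[OF cg] that topspace_U by auto
  have "openin ?E (f ` (V \<inter> U))"
    using homeomorphic_imp_open_map[OF homeo] V(1) open_U
    unfolding open_map_def by (simp add: openin_open_subtopology openin_Int)
  then obtain B where B: "openin ?E B" "f m \<in> B" "B \<subseteq> f ` (V \<inter> U)"
    "\<And>u v t. u \<in> B \<Longrightarrow> v \<in> B \<Longrightarrow> 0 \<le> t \<Longrightarrow> t \<le> 1 \<Longrightarrow> (\<lambda>i. (1-t) * u i + t * v i) \<in> B"
    by (rule Euclidean_space_convex_neighbourhood[of n _ "f m"]) (use V m in auto)
  have BE: "B \<subseteq> topspace ?E" using openin_subset[OF B(1)] .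
  define W where "W = {x \<in> U. f x \<in> B}"
  have "openin (subtopology M U) W"
    using openin_continuous_map_preimage[OF homeomorphic_imp_continuous_map[OF homeo] B(1)]
    unfolding topspace_U W_def .
  then have W: "openin M W" using open_U openin_trans_full by blast
  have gB: "g y \<in> W" if "y \<in> B" for y
    using that gU fg BE unfolding W_def by auto
  have WV: "W \<subseteq> V"
  proof
    fix x assume x: "x \<in> W"
    then obtain z where "z \<in> V" "z \<in> U" "f x = f z" using B(3) unfolding W_def by blast
    then show "x \<in> V" using gf x unfolding W_def by (metis mem_Collect_eq)
  qed
  \<comment> \<open>As \<open>P\<close> fails at \<open>0\<close>, the condition on the last
    coordinate already excludes the points of \<open>H\<close>.\<close>
  have img: "{x \<in> W - H. P (f x (n - 1))} = g ` {u \<in> B. P (u (n - 1))}" if "\<not> P 0" for P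
  proof (intro equalityI subsetI)
    fix x assume x: "x \<in> {x \<in> W - H. P (f x (n - 1))}"
    then have "x = g (f x)" "f x \<in> {u \<in> B. P (u (n - 1))}" using gf unfolding W_def by auto
    then show "x \<in> g ` {u \<in> B. P (u (n - 1))}" by (rule image_eqI)
  next
    fix x assume "x \<in> g ` {u \<in> B. P (u (n - 1))}"
    then obtain u where u: "u \<in> B" "P (u (n - 1))" "x = g u" by blast
    then have "x \<in> W" "f x = u" using gB fg BE by auto
    moreover from this have "x \<notin> H" using in_hypersurface_iff u that unfolding W_def by auto
    ultimately show "x \<in> {x \<in> W - H. P (f x (n - 1))}" using u by simp
  qed
  have conn: "connectedin M (g ` {u \<in> B. P (u (n - 1))})"
    if "\<And>a b t. P a \<Longrightarrow> P b \<Longrightarrow> 0 \<le> t \<Longrightarrow> t \<le> 1 \<Longrightarrow> P ((1-t) * a + t * b)" for P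
  proof -
    have "connectedin ?E {u \<in> B. P (u (n - 1))}"
      by (rule connectedin_Euclidean_space_segments) (use BE B(4) that in auto)
    then show ?thesis
      using connectedin_continuous_map_image[OF cg] by (simp add: connectedin_subtopology)
  qed
  \<comment> \<open>The second half is phrased as the negation of the label; off \<open>H\<close>
    the coordinate is nonzero, so this is the negative half, which is convex.\<close>
  have neg: "{x \<in> W - H. \<not> f x (n - 1) > 0} = {x \<in> W - H. f x (n - 1) < 0}"
    using in_hypersurface_iff unfolding W_def by force
  have convp: "0 < (1-t) * a + t * b" if "0 < a" "0 < b" "0 \<le> t" "t \<le> 1" for a b t :: real
    using convexD_alt[OF convex_real_interval(3)[of 0], of a b t] that by simp
  have convn: "(1-t) * a + t * b < 0" if "a < 0" "b < 0" "0 \<le> t" "t \<le> 1" for a b t :: real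
    using convexD_alt[OF convex_real_interval(4)[of 0], of a b t] that by simp
  \<comment> \<open>The normal line: only the last coordinate varies, and parameter \<open>0\<close>
    gives \<open>f m\<close> because \<open>m\<close> lies on \<open>H\<close>.\<close>
  define l where "l t = (f m)(n - 1 := t)" for t :: real
  have fm: "f m \<in> topspace ?E" using B(2) BE by blast
  have m0: "f m (n - 1) = 0" using in_hypersurface_iff m by blast
  have "continuous_map euclideanreal (powertop_real UNIV) l"
    unfolding continuous_map_componentwise_UNIV l_def
    by (auto simp: fun_upd_apply)
  then have l: "continuous_map euclideanreal ?E l"
    unfolding Euclidean_space_def continuous_map_in_subtopology
    using fm n by (auto simp: l_def topspace_Euclidean_space)
  have "open {t. l t \<in> B}"
    using openin_continuous_map_preimage[OF l B(1)] by simp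
  moreover have "0 \<in> {t. l t \<in> B}" using B(2) m0 by (simp add: l_def fun_upd_idem)
  ultimately obtain e where e: "e > 0" "ball 0 e \<subseteq> {t. l t \<in> B}"
    using open_contains_ball by blast
  then have "l (e/2) \<in> B" "l (-e/2) \<in> B" by (auto simp: subset_iff)
  moreover have "l t (n - 1) = t" for t by (simp add: l_def)
  ultimately have "l (e/2) \<in> {u \<in> B. u (n - 1) > 0}" "l (-e/2) \<in> {u \<in> B. u (n - 1) < 0}"
    using e(1) by auto
  then have ne: "{u \<in> B. u (n - 1) > 0} \<noteq> {}" "{u \<in> B. u (n - 1) < 0} \<noteq> {}"
    by blast+
  show thesis
  proof (rule that[OF W _ WV])
    show "m \<in> W" "W \<subseteq> U" using m B(2) by (auto simp: W_def)
    show "connectedin M {x \<in> W - H. f x (n - 1) > 0}" "{x \<in> W - H. f x (n - 1) > 0} \<noteq> {}"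
      using img[of "\<lambda>a. a > 0"] conn[of "\<lambda>a. a > 0"] convp ne by auto
    show "connectedin M {x \<in> W - H. \<not> f x (n - 1) > 0}" "{x \<in> W - H. \<not> f x (n - 1) > 0} \<noteq> {}"
      unfolding neg using img[of "\<lambda>a. a < 0"] conn[of "\<lambda>a. a < 0"] convn ne by auto
  qed
qed

end

section \<open>The atlas of sides of a closed hypersurface\<close>

lemma equal_or_opposite:
  assumes "\<And>x. x \<in> S \<Longrightarrow> (P x = Q x) = e"
  shows "(\<forall>x\<in>S. P x = Q x) \<or> (\<forall>x\<in>S. P x \<noteq> Q x)"
  using assms by (cases e) simp_all

text \<open>A point \<open>y\<close> off \<open>H\<close> gets the whole complement, open as
  \<open>H\<close> is closed, with the constant label. The substance is \<open>compatible\<close>: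
  off \<open>H\<close> all labels are locally constant, while at a point of \<open>H\<close> the two
  connected halves of one chart must match the two sides of the other, in one order or the
  other.\<close>

lemma side_atlas_flat_charts:
  fixes n :: nat and H :: "'a set"
  assumes chart: "\<And>p. p \<in> H \<Longrightarrow> flat_chart n M H (U p) (f p)" "\<And>p. p \<in> H \<Longrightarrow> p \<in> U p"
    and H: "closedin M H"
  shows "side_atlas M H (\<lambda>y. if y \<in> H then U y else topspace M - H)
    (\<lambda>y x. y \<in> H \<longrightarrow> f y x (n - 1) > 0)"
    (is "side_atlas M H ?U ?s")
proof
  show op: "openin M (topspace M - H)" using H by blast
  show oU: "openin M (?U y)" for y
    using op flat_chart.open_U[OF chart(1)] by simp
  show "y \<in> ?U y" if "y \<in> topspace M" for y using that chart(2) by simp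
  show "?s y x" if "y \<in> topspace M - H" "x \<in> topspace M - H" for y x using that by simp
  show "W - H \<noteq> {}" if W: "openin M W" "m \<in> W" for W m
  proof (cases "m \<in> H")
    case True
    show ?thesis
      by (rule flat_chart.two_sided_neighbourhood[OF chart(1)[OF True] W chart(2)[OF True] True]) blast
  qed (use W in blast)
  have loc: "\<exists>W. openin M W \<and> m \<in> W \<and> (\<forall>x\<in>W. ?s y x = ?s y m)" if m: "m \<in> ?U y" "m \<notin> H" for y m
  proof (cases "y \<in> H")
    case True
    interpret flat_chart n M H "U y" "f y" by (rule chart(1)[OF True])
    have mU: "m \<in> U y" using m(1) True by simp
    have "f y m (n - 1) \<noteq> 0" using in_hypersurface_iff[OF mU] m(2) by simp
    then consider "f y m (n - 1) > 0" | "f y m (n - 1) < 0" by linarith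
    then show ?thesis
    proof cases
      case 1
      then show ?thesis
        using openin_coordinate[OF open_greaterThan[of 0], of "n - 1"] mU
        by (intro exI[of _ "{x \<in> U y. f y x (n - 1) \<in> {0<..}}"]) simp
    next
      case 2
      then show ?thesis
        using openin_coordinate[OF open_lessThan[of 0], of "n - 1"] mU
        by (intro exI[of _ "{x \<in> U y. f y x (n - 1) \<in> {..<0}}"]) auto
    qed
  next
    case False
    then show ?thesis using op m(1) by (intro exI[of _ "topspace M - H"]) auto
  qed
  show "\<exists>W. openin M W \<and> m \<in> W \<and> ((\<forall>x\<in>W - H. ?s y x = ?s z x) \<or> (\<forall>x\<in>W - H. ?s y x \<noteq> ?s z x))"
    if m: "m \<in> ?U y" "m \<in> ?U z" for y z m
  proof (cases "m \<in> H")
    case False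
    obtain A where A: "openin M A" "m \<in> A" "\<forall>x\<in>A. ?s y x = ?s y m"
      using loc[OF m(1) False] by (elim exE conjE)
    obtain B where B: "openin M B" "m \<in> B" "\<forall>x\<in>B. ?s z x = ?s z m"
      using loc[OF m(2) False] by (elim exE conjE)
    have "(?s y x = ?s z x) = (?s y m = ?s z m)" if x: "x \<in> A \<inter> B - H" for x
    proof -
      have "x \<in> A" "x \<in> B" using x by auto
      from bspec[OF A(3) this(1)] bspec[OF B(3) this(2)] show ?thesis by argo
    qed
    then have "(\<forall>x\<in>A \<inter> B - H. ?s y x = ?s z x) \<or> (\<forall>x\<in>A \<inter> B - H. ?s y x \<noteq> ?s z x)"
      by (rule equal_or_opposite)
    then show ?thesis using A(1,2) B(1,2) by (intro exI[of _ "A \<inter> B"] conjI openin_Int IntI)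
  next
    case True
    \<comment> \<open>The chart domain of a point off \<open>H\<close> misses \<open>H\<close>, so
      both charts here are flat charts.\<close>
    then have yz: "y \<in> H" "z \<in> H" using m by (auto split: if_splits)
    have mU: "m \<in> U y" "m \<in> U z" using m yz by auto
    have V: "openin M (U y \<inter> U z)" "m \<in> U y \<inter> U z"
      using flat_chart.open_U[OF chart(1)] yz mU by auto
    let ?P = "\<lambda>W. {x \<in> W - H. ?s y x}" and ?N = "\<lambda>W. {x \<in> W - H. \<not> ?s y x}"
    have sy: "?s y x \<longleftrightarrow> f y x (n - 1) > 0" "?s z x \<longleftrightarrow> f z x (n - 1) > 0" for x using yz by auto
    obtain W where W: "openin M W" "m \<in> W" "W \<subseteq> U y \<inter> U z"
      "connectedin M (?P W)" "connectedin M (?N W)"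
      unfolding sy by (rule flat_chart.two_sided_neighbourhood[OF chart(1)[OF yz(1)] V mU(1) True])
    \<comment> \<open>Adapted to the chart of \<open>z\<close> and inside \<open>W\<close>, this
      neighbourhood shows that the label of \<open>z\<close> takes both values on
      \<open>W - H\<close>.\<close>
    obtain W' where W': "W' \<subseteq> W"
      "{x \<in> W' - H. f z x (n - 1) > 0} \<noteq> {}" "{x \<in> W' - H. \<not> f z x (n - 1) > 0} \<noteq> {}"
      by (rule flat_chart.two_sided_neighbourhood[OF chart(1)[OF yz(2)] W(1,2) mU(2) True])
    have const: "?s z a = ?s z b" if C: "connectedin M C" "C \<subseteq> W - H" and ab: "a \<in> C" "b \<in> C" for C a b
    proof (rule connectedin_locally_constant[OF C(1) _ ab])
      fix x assume x: "x \<in> C"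
      then have "x \<in> ?U z" "x \<notin> H" using C(2) W(3) yz by auto
      then obtain T where T: "openin M T" "x \<in> T" "\<forall>w\<in>T. ?s z w = ?s z x"
        using loc[of x z, OF \<open>x \<in> ?U z\<close> \<open>x \<notin> H\<close>] by (elim exE conjE)
      have "openin (subtopology M C) (C \<inter> T)" using T(1) by (rule openin_subtopology_Int2)
      moreover have "x \<in> C \<inter> T" using x T(2) by simp
      moreover have "\<forall>w\<in>C \<inter> T. ?s z w = ?s z x" using T(3)
        by (intro ballI) (rule bspec, assumption, erule IntD2)
      ultimately show "\<exists>T. openin (subtopology M C) T \<and> x \<in> T \<and> (\<forall>w\<in>T. ?s z w = ?s z x)"
        by (intro exI conjI)
    qed
    obtain a b where ab: "a \<in> W - H" "b \<in> W - H" "?s z a" "\<not> ?s z b"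
      using W' yz by blast
    have P: "?s z u = ?s z v" if "u \<in> W - H" "v \<in> W - H" "?s y u" "?s y v" for u v
      by (rule const[OF W(4)]) (use that in auto)
    have N: "?s z u = ?s z v" if "u \<in> W - H" "v \<in> W - H" "\<not> ?s y u" "\<not> ?s y v" for u v
      by (rule const[OF W(5)]) (use that in auto)
    \<comment> \<open>The label of \<open>z\<close> is constant on each half of \<open>W - H\<close>
      and distinguishes \<open>a\<close> from \<open>b\<close>, so these lie in different halves.
      Hence \<open>a\<close> and \<open>b\<close> represent both halves, and the sign found at
      \<open>a\<close> is valid on all of \<open>W - H\<close>.\<close>
    have d: "?s y a \<noteq> ?s y b"
      using P[OF ab(1,2)] N[OF ab(1,2)] ab(3,4) by argo
    have "(?s y x = ?s z x) = (?s y a = ?s z a)" if x: "x \<in> W - H" for x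
      using P[OF x ab(1)] N[OF x ab(1)] P[OF x ab(2)] N[OF x ab(2)] d ab(3,4) by argo
    then have "(\<forall>x\<in>W - H. ?s y x = ?s z x) \<or> (\<forall>x\<in>W - H. ?s y x \<noteq> ?s z x)"
      by (rule equal_or_opposite)
    then show ?thesis using W(1,2) by (intro exI[of _ W] conjI)
  qed
qed

section \<open>A loop crossing the hypersurface once\<close>

text \<open>The inverse chart carries the normal axis through the origin into \<open>M\<close>.
  Parametrised by the last coordinate, it meets \<open>H\<close> at parameter \<open>0\<close> only
  and changes sides there.\<close>

lemma (in flat_chart) transversal:
  assumes "f p = (\<lambda>_. 0)" "p \<in> U"
  obtains c where "continuous_map euclideanreal M c" "c 0 = p" "\<And>t. c t \<in> U"
    "\<And>t. f (c t) (n - 1) = t" "\<And>t. c t \<in> H \<longleftrightarrow> t = 0"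
proof -
  let ?E = "Euclidean_space n"
  obtain g where g: "homeomorphic_maps (subtopology M U) ?E f g"
    using homeo unfolding homeomorphic_map_maps by blast
  define l where "l t = (\<lambda>i. if i = n - 1 then t else 0)" for t :: real
  have "continuous_map euclideanreal (powertop_real UNIV) l"
    unfolding continuous_map_componentwise_UNIV l_def by auto
  then have l: "continuous_map euclideanreal ?E l"
    unfolding Euclidean_space_def continuous_map_in_subtopology
    using n by (auto simp: l_def)
  have cg: "continuous_map ?E (subtopology M U) g" using g unfolding homeomorphic_maps_def by blast
  have gl: "continuous_map euclideanreal (subtopology M U) (g \<circ> l)"
    using l cg by (rule continuous_map_compose)
  have lE: "l t \<in> topspace ?E" for t using continuous_map_funspace[OF l] by auto
  have U: "(g \<circ> l) t \<in> U" for t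
    using continuous_map_funspace[OF gl] topspace_U by auto
  have fgl: "f ((g \<circ> l) t) = l t" for t
    using g lE unfolding homeomorphic_maps_def by simp
  show thesis
  proof (rule that[of "g \<circ> l"])
    show "continuous_map euclideanreal M (g \<circ> l)"
      using gl by (simp add: continuous_map_in_subtopology)
    have "l 0 = f p" using assms by (simp add: l_def fun_eq_iff)
    moreover have "g (f p) = p" using g assms topspace_U unfolding homeomorphic_maps_def by blast
    ultimately show "(g \<circ> l) 0 = p" by simp
    show "(g \<circ> l) t \<in> U" for t by (rule U)
    show "f ((g \<circ> l) t) (n - 1) = t" for t unfolding fgl by (simp add: l_def)
    then show "(g \<circ> l) t \<in> H \<longleftrightarrow> t = 0" for t using in_hypersurface_iff[OF U] by simp
  qed
qed

theorem corollary5p7: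
  fixes M :: "'a topology" and n :: nat and H :: "'a set"
  assumes "manifold n M"
    and "simply_connected_space M"
    and "hypersurface n M H"
    and "closedin M H"
  shows "divides H M"
  unfolding divides_def
proof
  assume conn: "connected_space (subtopology M (topspace M - H))"
  let ?C = "subtopology M (topspace M - H)"
  have n: "n \<ge> 1" and "H \<noteq> {}" and "\<forall>p\<in>H. \<exists>U f. openin M U \<and> p \<in> U \<and>
        homeomorphic_map (subtopology M U) (Euclidean_space n) f \<and>
        f ` (U \<inter> H) = {x \<in> topspace (Euclidean_space n). x (n - 1) = 0} \<and> f p = (\<lambda>_. 0)"
    using assms(3) unfolding hypersurface_def by blast+
  then have "\<forall>p\<in>H. \<exists>U f. flat_chart n M H U f \<and> p \<in> U \<and> f p = (\<lambda>_. 0)"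
    unfolding flat_chart_def by meson
  then obtain U f where chart: "\<And>p. p \<in> H \<Longrightarrow> flat_chart n M H (U p) (f p)" "\<And>p. p \<in> H \<Longrightarrow> p \<in> U p"
    and f0: "\<And>p. p \<in> H \<Longrightarrow> f p p = (\<lambda>_. 0)"
    by metis
  interpret side_atlas M H "\<lambda>y. if y \<in> H then U y else topspace M - H"
    "\<lambda>y x. y \<in> H \<longrightarrow> f y x (n - 1) > 0"
    using chart assms(4) by (rule side_atlas_flat_charts)
  obtain p where p: "p \<in> H" using \<open>H \<noteq> {}\<close> by blast
  obtain c :: "real \<Rightarrow> 'a" where c: "continuous_map euclideanreal M c" "c 0 = p" "\<And>t. c t \<in> U p"
    "\<And>t. f p (c t) (n - 1) = t" "\<And>t. c t \<in> H \<longleftrightarrow> t = 0"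
    using flat_chart.transversal[OF chart(1)[OF p] f0[OF p] chart(2)[OF p]] by metis
  have "path_connected_space ?C"
    using path_connected_eq_connected_space[OF locally_path_connected_space_open_subset[OF
      locally_path_connected_space_manifold[OF assms(1)] open_complement]] conn by blast
  moreover have cM: "c t \<in> topspace M" for t using continuous_map_funspace[OF c(1)] by auto
  then have "c 1 \<in> topspace ?C" "c (-1) \<in> topspace ?C" using c(5) by auto
  ultimately obtain d where d: "pathin ?C d" "d 0 = c 1" "d 1 = c (-1)"
    unfolding path_connected_space_def by blast
  have dM: "continuous_map (top_of_set {0..1}) M d"
    using d(1) unfolding pathin_def continuous_map_in_subtopology by blast
  have dH: "d t \<notin> H" if "0 \<le> t" "t \<le> 1" for t
    using continuous_map_funspace[OF d(1)[unfolded pathin_def]] that by auto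
  \<comment> \<open>The first half follows the transversal from \<open>c (-1)\<close> to
    \<open>c 1\<close> and passes \<open>p\<close> at time \<open>1/4\<close>; the second half
    returns along \<open>d\<close> in the complement of \<open>H\<close>.\<close>
  define g where "g t = (if t \<le> 1/2 then c (4 * t - 1) else d (2 * t - 1))" for t :: real
  have "continuous_map (top_of_set {0..1}) M g"
    unfolding g_def
  proof (rule continuous_map_cases_le)
    show "continuous_map (subtopology (top_of_set {0..1}) {x \<in> topspace (top_of_set {0..1}). x \<le> 1/2}) M (\<lambda>t. c (4 * t - 1))"
      by (rule continuous_map_compose[OF _ c(1), unfolded o_def])
        (auto simp: subtopology_subtopology intro!: continuous_intros)
    show "continuous_map (subtopology (top_of_set {0..1}) {x \<in> topspace (top_of_set {0..1}). 1/2 \<le> x}) M (\<lambda>t. d (2 * t - 1))"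
      by (rule continuous_map_compose[OF _ dM, unfolded o_def])
        (auto simp: continuous_map_in_subtopology subtopology_subtopology intro!: continuous_intros)
    show "c (4 * t - 1) = d (2 * t - 1)" if "t = 1/2" for t
      using d(2) unfolding that by simp
  qed auto
  then have "pathin M g" by (simp add: pathin_def)
  moreover have "g 0 = c (-1)" "g 1 = c (-1)" using d by (auto simp: g_def)
  ultimately have hom: "homotopic_with (\<lambda>r. r 0 = c (-1) \<and> r 1 = c (-1)) (top_of_set {0..1::real}) M g (\<lambda>_. c (-1))"
    using assms(2) cM unfolding simply_connected_space_def by blast
  have gp: "g (1/4) = p" using c(2) by (simp add: g_def)
  \<comment> \<open>Within distance \<open>1/4\<close> of the crossing time the loop is still on the
    transversal, where the last coordinate is \<open>4 * t - 1\<close> and so is positive exactly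
    after time \<open>1/4\<close>.\<close>
  from hom show False
  proof (rule single_crossing_not_null_homotopic[where c = "1/4" and d = "1/4"])
    show "g t \<notin> H" if "0 \<le> t" "t \<le> 1" "t \<noteq> 1/4" for t
      using that c(5) dH by (auto simp: g_def)
    show "g t \<in> (if g (1/4) \<in> H then U (g (1/4)) else topspace M - H) \<and>
        (t \<noteq> 1/4 \<longrightarrow> (g (1/4) \<in> H \<longrightarrow> f (g (1/4)) (g t) (n - 1) > 0) = (1/4 < t))"
      if "0 \<le> t" "t \<le> 1" "\<bar>t - 1/4\<bar> < 1/4" for t
    proof -
      have "t \<le> 1/2" using that(3) by arith
      then have "g t = c (4 * t - 1)" by (simp add: g_def)
      then show ?thesis unfolding gp using p c(3,4) by auto
    qed
  qed (use c(5) in auto)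
qed

end
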